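(* Let $\mathcal A$ be the affine space of functions $\varphi:\mathbb Z^2\to\mathbb R$ satisfying $\sum_{p\in\mathbb Z^2}\varphi(p)=1$. An affine operator $M$ with domain $\mathcal A$ and values in $\mathbb R^2$ which satisfies the equivariance property $$M(T_{u,v}\varphi)=T'_{u,v}(M(\varphi))\qquad\text{for all }(u,v)\in\mathbb Z^2,\ \varphi\in\mathcal A,$$ has to be of the form $$M(\varphi)=C+\sum_{p\in\mathbb Z^2}\varphi(p)\,p$$ for some constant $C\in\mathbb R^2$.
   Context: The group of translations $\mathbb Z^2$ acts on scalar-valued functions $\varphi$ on $\mathbb Z^2$ by $T_{u,v}(\varphi)(i,j)=\varphi(i-u,j-v)$, and on coordinates by $T'_{u,v}(i,j)=(i+u,j+v)$ (the same formula being used for $(i,j)\in\mathbb R^2$). An operator $M$ on $\mathcal A$ is called affine if, for all $\alpha_i\in\mathbb R$ and $\varphi_i\in\mathcal A$ such that $\sum_i\alpha_i=1$, one has $M(\sum_i\alpha_i\varphi_i)=\sum_i\alpha_i M(\varphi_i)$. The index set of the family is not restricted to be finite; in particular the condition covers families indexed by $\mathbb Z^2$, such as the decomposition $\varphi=\sum_{q\in\mathbb Z^2}\varphi(q)\,\delta(\cdot-q)$, where $\delta(p)=1$ for $p=(0,0)$ and $\delta(p)=0$ otherwise. In $\sum_{p\in\mathbb Z^2}\varphi(p)\,p$, each $p\in\mathbb Z^2$ is regarded as a vector in $\mathbb R^2$.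
   Formalization: The formula is asserted for those φ in A for which Σ φ(p) p converges (unconditionally), as otherwise it is undefined; affinity is required for all finite families and for infinite ones where Σ α_i φ_i(p) and Σ α_i φ_i(p) p converge as double sums. *)

theory Defs
  imports "HOL-Analysis.Analysis"
begin

definition domA :: "(int \<times> int \<Rightarrow> real) set"
  where "domA = {\<phi>. (\<phi> has_sum 1) UNIV}"

definition vec2 :: "int \<times> int \<Rightarrow> real \<times> real"
  where "vec2 p = (real_of_int (fst p), real_of_int (snd p))"

definition translate :: "int \<Rightarrow> int \<Rightarrow> (int \<times> int \<Rightarrow> real) \<Rightarrow> (int \<times> int \<Rightarrow> real)"
  where "translate u v \<phi> = (\<lambda>(i, j). \<phi> (i - u, j - v))"

definition translate' :: "int \<Rightarrow> int \<Rightarrow> real \<times> real \<Rightarrow> real \<times> real"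
  where "translate' u v = (\<lambda>(x, y). (x + real_of_int u, y + real_of_int v))"

text \<open>
  The families for which an affine combination is formed: all finite ones, and those infinite ones
  for which the double families \<open>\<alpha> i * \<phi> i p\<close> and \<open>(\<alpha> i * \<phi> i p) *\<^sub>R p\<close> are (unconditionally)
  summable over all pairs \<open>(i, p)\<close>, so that summation over \<open>i\<close> and over \<open>p\<close> may be interchanged.

  Some such condition is needed for infinite families. If only pointwise (or even absolute
  \<open>l\<^sup>1\<close>) convergence of \<open>\<Sum>i. \<alpha> i * \<phi> i\<close> were asked for, then no equivariant operator would be
  affine. Take \<open>s i = (\<delta> (\<cdot> - (2 ^ i, 0)) - \<delta>) / 2 ^ i\<close>, \<open>\<alpha> i = 1 / 2 ^ i\<close> and
  \<open>\<phi> i = \<delta> + 2 ^ i * (s (i + 1) - s i)\<close> for \<open>i \<ge> 1\<close>. Finite affine combinations and equivariance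
  give \<open>M (\<phi> i) = M \<delta>\<close> for all \<open>i\<close>, whereas \<open>\<Sum>i. \<alpha> i * \<phi> i = \<delta> - s 1\<close> and
  \<open>M (\<delta> - s 1) = M \<delta> - (1, 0)\<close>.
\<close>

definition admissible ::
    "(int \<times> int) set \<Rightarrow> (int \<times> int \<Rightarrow> real) \<Rightarrow> (int \<times> int \<Rightarrow> int \<times> int \<Rightarrow> real) \<Rightarrow> bool"
  where "admissible I \<alpha> \<phi> \<longleftrightarrow>
    finite I \<or>
    ((\<lambda>(i, p). \<alpha> i * \<phi> i p) summable_on I \<times> UNIV \<and>
     (\<lambda>(i, p). (\<alpha> i * \<phi> i p) *\<^sub>R vec2 p) summable_on I \<times> UNIV)"

text \<open>
  Index sets are arbitrary subsets of \<open>\<int> \<times> \<int>\<close>. This is no restriction: if \<open>\<alpha>\<close> is summable, then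
  only countably many \<open>\<alpha> i\<close> are nonzero. Only the values of \<open>M\<close> on \<open>domA\<close> matter.
\<close>

definition affine_operator :: "((int \<times> int \<Rightarrow> real) \<Rightarrow> real \<times> real) \<Rightarrow> bool"
  where "affine_operator M \<longleftrightarrow>
    (\<forall>I \<alpha> \<phi>. (\<alpha> has_sum 1) I \<longrightarrow> (\<forall>i\<in>I. \<phi> i \<in> domA) \<longrightarrow> admissible I \<alpha> \<phi> \<longrightarrow>
      ((\<lambda>i. \<alpha> i *\<^sub>R M (\<phi> i)) has_sum M (\<lambda>p. \<Sum>\<^sub>\<infinity>i\<in>I. \<alpha> i * \<phi> i p)) I)"

definition translation_equivariant :: "((int \<times> int \<Rightarrow> real) \<Rightarrow> real \<times> real) \<Rightarrow> bool"
  where "translation_equivariant M \<longleftrightarrow>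
    (\<forall>u v. \<forall>\<phi>\<in>domA. M (translate u v \<phi>) = translate' u v (M \<phi>))"

end

theory Submission
  imports Defs
begin

text \<open>
  Apply affinity to the decomposition of \<open>\<phi>\<close> into the point masses \<open>\<delta>(\<cdot> - q)\<close> with weights
  \<open>\<phi>(q)\<close>. Equivariance forces \<open>M(\<delta>(\<cdot> - q)) = M(\<delta>) + q\<close>, and the weights sum to 1, so the
  constant is \<open>C = M(\<delta>)\<close>.
\<close>

text \<open>The centre \<open>q\<close> comes first so that \<open>point_mass\<close> is itself a
  family of functions indexed by the whole lattice, the shape \<open>admissible\<close>
  expects.\<close>

definition point_mass :: "int \<times> int \<Rightarrow> int \<times> int \<Rightarrow> real"
  where "point_mass q p = of_bool (p = q)"

lemma point_mass_in_domA: "point_mass q \<in> domA"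
proof -
  have "(point_mass q has_sum 1) UNIV \<longleftrightarrow> (point_mass q has_sum 1) {q}"
    by (rule has_sum_cong_neutral) (auto simp: point_mass_def)
  moreover have "(point_mass q has_sum 1) {q}"
    using has_sum_finite[of "{q}" "point_mass q"] by (simp add: point_mass_def)
  ultimately show ?thesis
    by (simp add: domA_def)
qed

lemma translate_point_mass: "translate u v (point_mass 0) = point_mass (u, v)"
  by (auto simp: translate_def point_mass_def fun_eq_iff zero_prod_def)

lemma translate'_eq_add_vec2: "translate' u v x = x + vec2 (u, v)"
  by (cases x) (simp add: translate'_def vec2_def)

lemma equivariant_point_mass:
  assumes "translation_equivariant M"
  shows "M (point_mass q) = M (point_mass 0) + vec2 q"
proof (cases q)
  case (Pair u v)
  have "M (translate u v (point_mass 0)) = translate' u v (M (point_mass 0))"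
    using assms point_mass_in_domA by (auto simp: translation_equivariant_def)
  then show ?thesis
    by (simp add: Pair translate_point_mass translate'_eq_add_vec2)
qed

text \<open>Only the term \<open>q = p\<close> survives. This identifies the affine combination of
  point masses with weights \<open>\<phi>\<close> as \<open>\<phi>\<close> itself.\<close>

lemma infsum_mult_point_mass: "(\<Sum>\<^sub>\<infinity>q. \<phi> q * point_mass q p) = \<phi> p"
proof -
  have "(\<Sum>\<^sub>\<infinity>q. \<phi> q * point_mass q p) = (\<Sum>\<^sub>\<infinity>q\<in>{p}. \<phi> q * point_mass q p)"
    by (rule infsum_cong_neutral) (auto simp: point_mass_def)
  then show ?thesis
    by (simp add: point_mass_def)
qed

text \<open>Off-diagonal terms vanish, so only the image of the injection
  \<open>p \<mapsto> (p, p)\<close> matters, and reindexing along it gives the single sum.\<close>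

lemma summable_on_diagonal:
  fixes f :: "'a \<times> 'a \<Rightarrow> 'b :: {comm_monoid_add, topological_space}"
  assumes "(\<lambda>p. f (p, p)) summable_on UNIV"
    and "\<And>q p. q \<noteq> p \<Longrightarrow> f (q, p) = 0"
  shows "f summable_on UNIV \<times> UNIV"
proof -
  have "f summable_on range (\<lambda>p. (p, p))"
    using assms(1) by (subst summable_on_reindex) (auto simp: inj_on_def o_def)
  moreover have "f summable_on UNIV \<times> UNIV \<longleftrightarrow> f summable_on range (\<lambda>p. (p, p))"
    by (rule summable_on_cong_neutral) (use assms(2) in \<open>auto simp: image_iff\<close>)
  ultimately show ?thesis
    by simp
qed

text \<open>Both double families live on the diagonal, where they reduce to \<open>\<phi> p\<close>
  and \<open>\<phi> p *\<^sub>R vec2 p\<close>: total mass and first moment.\<close>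

lemma admissible_point_mass:
  assumes "\<phi> \<in> domA" and "(\<lambda>p. \<phi> p *\<^sub>R vec2 p) summable_on UNIV"
  shows "admissible UNIV \<phi> point_mass"
proof -
  have "\<phi> summable_on UNIV"
    using assms(1) by (auto simp: domA_def summable_on_def)
  then show ?thesis
    unfolding admissible_def using assms(2)
    by (intro disjI2 conjI summable_on_diagonal) (auto simp: point_mass_def)
qed

text \<open>The summability premise says that the first moment exists; otherwise the infinite sum
  would denote the default value 0.\<close>

theorem proposition2p1:
  fixes M :: "(int \<times> int \<Rightarrow> real) \<Rightarrow> real \<times> real"
  assumes "affine_operator M"
    and "translation_equivariant M"
  shows "\<exists>C. \<forall>\<phi>\<in>domA. (\<lambda>p. \<phi> p *\<^sub>R vec2 p) summable_on UNIV \<longrightarrow>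
           M \<phi> = C + (\<Sum>\<^sub>\<infinity>p. \<phi> p *\<^sub>R vec2 p)"
proof -
  define C where "C = M (point_mass 0)"
  have M_point_mass: "M (point_mass q) = C + vec2 q" for q
    unfolding C_def by (rule equivariant_point_mass[OF assms(2)])
  have "M \<phi> = C + (\<Sum>\<^sub>\<infinity>p. \<phi> p *\<^sub>R vec2 p)"
    if \<phi>: "\<phi> \<in> domA" and summable: "(\<lambda>p. \<phi> p *\<^sub>R vec2 p) summable_on UNIV" for \<phi>
  proof -
    have sum_1: "(\<phi> has_sum 1) UNIV"
      using \<phi> by (simp add: domA_def)
    have "((\<lambda>q. \<phi> q *\<^sub>R M (point_mass q)) has_sum M (\<lambda>p. \<Sum>\<^sub>\<infinity>q. \<phi> q * point_mass q p)) UNIV"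
      using assms(1) sum_1 point_mass_in_domA admissible_point_mass[OF \<phi> summable]
      unfolding affine_operator_def by blast
    then have "((\<lambda>q. \<phi> q *\<^sub>R C + \<phi> q *\<^sub>R vec2 q) has_sum M \<phi>) UNIV"
      by (simp add: infsum_mult_point_mass M_point_mass scaleR_add_right)
    \<comment> \<open>The bounded linear map \<open>x \<mapsto> x *\<^sub>R C\<close> carries the
      total mass 1 to \<open>C\<close>; the second summand contributes the first moment.\<close>
    moreover have "((\<lambda>q. \<phi> q *\<^sub>R C + \<phi> q *\<^sub>R vec2 q) has_sum
        C + (\<Sum>\<^sub>\<infinity>p. \<phi> p *\<^sub>R vec2 p)) UNIV"
      using has_sum_add[OF has_sum_bounded_linear[OF bounded_linear_scaleR_left[of C] sum_1] has_sum_infsum[OF summable]] by simp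
    ultimately show ?thesis
      by (rule has_sum_unique)
  qed
  then show ?thesis
    by blast
qed

end
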